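(* Let $n\ge 2$ and $w\le n/2$ be positive integers, and let $\pi:\mathbb{Z}\to\mathbb{Z}$ be a bijection with $\pi(i+n)=\pi(i)+n$ for all $i$ and $|\pi(i)-i|\le w$ for all $i$ (equivalently, $\pi$ corresponds to a cyclically banded permutation $\bar\pi\in S_n$ of bandwidth $w$, i.e. $|\bar\pi_i-i|\le w$ or $|\bar\pi_i-i|\ge n-w$ for all $i$). Then $$\pi=\sigma^1\sigma^2\cdots\sigma^{2w-1}S^k,$$ where each $\sigma^i$ is a cyclic permutation of bandwidth $1$ that is a product of pairwise nonadjacent (modulo $n$) periodic simple transpositions, $S$ is the cyclic shift by $1$, and $k$ is an integer with $|k|\le w$.
   Context: For $r\in\mathbb{Z}/n\mathbb{Z}$, the periodic simple transposition $e_r$ (the cyclic analogue of $s_r=(r,r+1)$, with $s_0=s_n$ exchanging positions $n$ and $1$) is the bijection of $\mathbb{Z}$ exchanging $a$ and $a+1$ for every $a\equiv r\pmod n$ and fixing all other integers; $e_r$ and $e_{r'}$ are adjacent modulo $n$ if $r-r'\equiv\pm1\pmod n$. The cyclic shift $S$ is the periodic bijection $i\mapsto i+1$ of $\mathbb{Z}$ (corresponding to the cyclic shift $\pi_1\pi_2\cdots\pi_n\mapsto\pi_2\cdots\pi_n\pi_1$ on $S_n$). A periodic bijection $\rho$ has bandwidth $1$ if $|\rho(i)-i|\le1$ for all $i$. *)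

theory Defs
  imports Main
begin

definition per_transp :: "nat \<Rightarrow> int \<Rightarrow> int \<Rightarrow> int" where
  "per_transp n r a =
     (if a mod int n = r mod int n then a + 1
      else if (a - 1) mod int n = r mod int n then a - 1
      else a)"

definition adjacent_mod :: "nat \<Rightarrow> int \<Rightarrow> int \<Rightarrow> bool" where
  "adjacent_mod n r r' \<longleftrightarrow> (r - r') mod int n = 1 mod int n \<or> (r - r') mod int n = (-1) mod int n"

definition periodic_bij :: "nat \<Rightarrow> (int \<Rightarrow> int) \<Rightarrow> bool" where
  "periodic_bij n f \<longleftrightarrow> bij f \<and> (\<forall>i. f (i + int n) = f i + int n)"

definition bandwidth_le :: "int \<Rightarrow> (int \<Rightarrow> int) \<Rightarrow> bool" where
  "bandwidth_le w f \<longleftrightarrow> (\<forall>i. \<bar>f i - i\<bar> \<le> w)"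

definition shift_pow :: "int \<Rightarrow> int \<Rightarrow> int" where
  "shift_pow k i = i + k"

definition nonadj_transp_product :: "nat \<Rightarrow> (int \<Rightarrow> int) \<Rightarrow> bool" where
  "nonadj_transp_product n \<sigma> \<longleftrightarrow>
     periodic_bij n \<sigma> \<and> bandwidth_le 1 \<sigma> \<and>
     (\<exists>rs :: int list.
        distinct (map (\<lambda>r. r mod int n) rs) \<and>
        (\<forall>r\<in>set rs. \<forall>r'\<in>set rs. \<not> adjacent_mod n r r') \<and>
        \<sigma> = foldr (\<circ>) (map (per_transp n) rs) id)"

end

theory Submission
  imports Defs
begin

text \<open>
  Draw the wire of \<open>i\<close> in the permutation matrix of \<open>\<pi>\<close> as a hook: along row \<open>i\<close> up to the cell
  \<open>(i, \<pi> i)\<close>, then along column \<open>\<pi> i\<close> towards smaller rows, so that the diagonal index \<open>c = column - row\<close>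
  increases along every wire. Two wires cross exactly at the inversion cells, which satisfy
  \<open>\<bar>c\<bar> < w\<close>: there are \<open>2 * w - 1\<close> such diagonals. Each diagonal acts on the linearly ordered
  wires by swapping disjoint pairs of neighbours. Undoing the diagonals one at a time, starting
  from \<open>\<pi>\<close>, leaves an increasing bijection of the integers, which is a shift.
\<close>

section \<open>Swapping disjoint pairs of neighbouring integers\<close>

text \<open>For sparse \<open>R\<close> this is the product of the commuting transpositions of
  \<open>a\<close> and \<open>a + 1\<close> over \<open>a \<in> R\<close>, with no order of factors
  to choose.\<close>

definition swaps :: "int set \<Rightarrow> int \<Rightarrow> int" where
  "swaps R a = (if a \<in> R then a + 1 else if a - 1 \<in> R then a - 1 else a)"

definition sparse :: "int set \<Rightarrow> bool" where
  "sparse R \<longleftrightarrow> (\<forall>a\<in>R. a + 1 \<notin> R)"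

definition periodic_set :: "nat \<Rightarrow> int set \<Rightarrow> bool" where
  "periodic_set n R \<longleftrightarrow> (\<forall>a. a + int n \<in> R \<longleftrightarrow> a \<in> R)"

lemma swaps_swaps:
  assumes "sparse R"
  shows "swaps R (swaps R a) = a"
proof -
  have "a - 1 \<in> R \<Longrightarrow> a \<notin> R" "a \<in> R \<Longrightarrow> a + 1 \<notin> R"
    using assms unfolding sparse_def by force+
  then show ?thesis by (auto simp: swaps_def)
qed

lemma bij_swaps: "sparse R \<Longrightarrow> bij (swaps R)"
  by (rule o_bij[of "swaps R"]) (auto simp: fun_eq_iff swaps_swaps)

text \<open>Points move by at most 1, so only gaps 1 and 2 matter. At gap 2, both points moving
  inwards would need \<open>a\<close> and \<open>a + 1\<close> in \<open>R\<close>; at gap 1, any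
  inward move needs \<open>a \<in> R\<close>.\<close>

lemma swaps_less:
  assumes "sparse R" "a < b" "\<not> (a \<in> R \<and> b = a + 1)"
  shows "swaps R a < swaps R b"
proof -
  have "a \<in> R \<Longrightarrow> a + 1 \<notin> R" using assms(1) by (auto simp: sparse_def)
  moreover have "b = a + 1 \<or> b = a + 2 \<or> b > a + 2" using assms(2) by linarith
  ultimately show ?thesis using assms by (auto simp: swaps_def sparse_def add.commute[of 1])
qed

section \<open>Periodic sets and products of periodic transpositions\<close>

lemma periodic_set_add_mult:
  assumes "periodic_set n R"
  shows "a + int n * q \<in> R \<longleftrightarrow> a \<in> R"
proof (induction q arbitrary: a rule: int_induct[where k = 0])
  case (step1 i)
  have "a + int n * (i + 1) = (a + int n * i) + int n" by (simp add: algebra_simps)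
  then show ?case using step1 assms by (metis periodic_set_def)
next
  case (step2 i)
  have "a + int n * i = (a + int n * (i - 1)) + int n" by (simp add: algebra_simps)
  then show ?case using step2 assms by (metis periodic_set_def)
qed auto

lemma periodic_set_cong:
  assumes "periodic_set n R" "a mod int n = b mod int n"
  shows "a \<in> R \<longleftrightarrow> b \<in> R"
  using assms by (metis mod_eqE periodic_set_add_mult)

text \<open>Distinctness and nonadjacency make the supports of the factors disjoint, so the head of
  the list fixes every point moved by the tail.\<close>

lemma foldr_per_transp:
  assumes "n \<ge> 2" "distinct (map (\<lambda>r. r mod int n) rs)"
    and "\<forall>r\<in>set rs. \<forall>r'\<in>set rs. \<not> adjacent_mod n r r'"
  shows "foldr (\<circ>) (map (per_transp n) rs) id = swaps {a. \<exists>r\<in>set rs. a mod int n = r mod int n}"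
  using assms(2,3)
proof (induction rs)
  case Nil
  then show ?case by (auto simp: swaps_def fun_eq_iff)
next
  case (Cons r rs)
  let ?R = "{a. \<exists>s\<in>set rs. a mod int n = s mod int n}"
  have IH: "foldr (\<circ>) (map (per_transp n) rs) id = swaps ?R"
    by (rule Cons.IH) (use Cons.prems in auto)
  have adj: "x mod int n \<noteq> (y + 1) mod int n"
    if "x mod int n = s mod int n" "y mod int n = t mod int n" "s \<in> set (r # rs)" "t \<in> set (r # rs)"
    for x y s t
  proof
    assume "x mod int n = (y + 1) mod int n"
    then have "s mod int n = (t + 1) mod int n" using that(1,2) by (metis mod_add_left_eq)
    then have "(s - t) mod int n = (t + 1 - t) mod int n" by (metis mod_diff_left_eq)
    then have "adjacent_mod n s t" by (simp add: adjacent_mod_def)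
    with that Cons.prems show False by blast
  qed
  have dist: "s mod int n \<noteq> r mod int n" if "s \<in> set rs" for s
    using imageI[OF that, of "\<lambda>s. s mod int n"] Cons.prems(1) by auto
  let ?R' = "{a. \<exists>s\<in>set (r # rs). a mod int n = s mod int n}"
  have mem: "b \<in> ?R' \<longleftrightarrow> b mod int n = r mod int n \<or> b \<in> ?R" for b by simp
  have "per_transp n r (swaps ?R a) = swaps ?R' a" for a
  proof -
    consider (up) s where "s \<in> set rs" "a mod int n = s mod int n" "a \<in> ?R"
      | (down) s where "s \<in> set rs" "(a - 1) mod int n = s mod int n" "a - 1 \<in> ?R" "a \<notin> ?R"
      | (fixed) "a \<notin> ?R" "a - 1 \<notin> ?R"
      by blast
    then show ?thesis
    proof cases
      case up
      have "(a + 1) mod int n \<noteq> r mod int n"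
        using adj[of r r a s] up(1,2) by (metis list.set_intros)
      moreover have "a mod int n \<noteq> r mod int n" using dist up(1,2) by metis
      ultimately show ?thesis
        unfolding swaps_def per_transp_def mem using up(3) by (simp del: mem_Collect_eq)
    next
      case down
      have "(a - 1) mod int n \<noteq> r mod int n" using dist down(1,2) by metis
      moreover have "(a - 1 - 1) mod int n \<noteq> r mod int n"
        using adj[of "a - 1" s "a - 1 - 1" r] down(1,2) by (metis diff_add_cancel list.set_intros)
      moreover have "a mod int n \<noteq> r mod int n"
        using adj[of a r "a - 1" s] down(1,2) by (metis diff_add_cancel list.set_intros)
      ultimately show ?thesis
        unfolding swaps_def per_transp_def mem using down(3,4) by (simp del: mem_Collect_eq)
    next
      case fixed
      then show ?thesis
        unfolding swaps_def per_transp_def mem by (simp del: mem_Collect_eq)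
    qed
  qed
  then have "per_transp n r \<circ> swaps ?R = swaps ?R'" by (intro ext) (simp only: o_apply)
  then show ?case by (simp only: list.map foldr.simps o_apply[of "(\<circ>) (per_transp n r)"] IH)
qed

lemma swaps_add_period:
  assumes "periodic_set n R"
  shows "swaps R (a + int n) = swaps R a + int n"
proof -
  have "a + int n - 1 = a - 1 + int n" by simp
  then have "a + int n - 1 \<in> R \<longleftrightarrow> a - 1 \<in> R" using assms by (metis periodic_set_def)
  then show ?thesis using assms by (auto simp: swaps_def periodic_set_def)
qed

text \<open>The representatives of \<open>R\<close> in one period index the transpositions. By
  periodicity, adjacency modulo \<open>n\<close> would produce true neighbours in \<open>R\<close>,
  against sparsity.\<close>

lemma nonadj_transp_product_swaps:
  assumes n: "n \<ge> 2" and per: "periodic_set n R" and sp: "sparse R"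
  shows "nonadj_transp_product n (swaps R)"
proof -
  define rs where "rs = sorted_list_of_set (R \<inter> {0..<int n})"
  have set_rs: "set rs = R \<inter> {0..<int n}" by (simp add: rs_def)
  have "map (\<lambda>r. r mod int n) rs = map id rs"
    by (rule map_cong) (auto simp: set_rs)
  then have dist: "distinct (map (\<lambda>r. r mod int n) rs)" by (simp add: rs_def)
  have no: "(r - r') mod int n \<noteq> 1 mod int n" if "r \<in> R" "r' \<in> R" for r r'
  proof
    assume "(r - r') mod int n = 1 mod int n"
    then have "(r - r' + r') mod int n = (1 + r') mod int n" by (metis mod_add_left_eq)
    then have "r mod int n = (r' + 1) mod int n" by (simp add: add.commute)
    then have "r' + 1 \<in> R" using periodic_set_cong[OF per] that by blast
    then show False using sp that by (auto simp: sparse_def)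
  qed
  have "(r' - r) mod int n = 1 mod int n" if "(r - r') mod int n = (-1) mod int n" for r r'
    using that by (metis minus_diff_eq minus_minus mod_minus_eq)
  then have nonadj: "\<forall>r\<in>set rs. \<forall>r'\<in>set rs. \<not> adjacent_mod n r r'"
    using no set_rs unfolding adjacent_mod_def by blast
  have "a \<in> R \<longleftrightarrow> (\<exists>r\<in>set rs. a mod int n = r mod int n)" for a
  proof
    assume "a \<in> R"
    then have "a mod int n \<in> set rs"
      using n periodic_set_cong[OF per, of a "a mod int n"] by (auto simp: set_rs)
    then show "\<exists>r\<in>set rs. a mod int n = r mod int n" by (rule bexI[rotated]) simp
  qed (use periodic_set_cong[OF per] set_rs in blast)
  then have "R = {a. \<exists>r\<in>set rs. a mod int n = r mod int n}" by blast
  then have "swaps R = foldr (\<circ>) (map (per_transp n) rs) id"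
    using foldr_per_transp[OF n dist nonadj] by simp
  moreover have "periodic_bij n (swaps R)"
    using sp per by (simp add: periodic_bij_def bij_swaps swaps_add_period)
  moreover have "bandwidth_le 1 (swaps R)" by (auto simp: bandwidth_le_def swaps_def)
  ultimately show ?thesis using dist nonadj unfolding nonadj_transp_product_def by blast
qed

section \<open>Wires and their crossings on one diagonal\<close>

text \<open>
  Position at which the wire of \<open>x\<close> leaves diagonal \<open>c\<close>: odd numbers \<open>2 * i + 1\<close> are the horizontal
  exits from row \<open>i\<close>, even numbers \<open>2 * i\<close> the vertical exits from row \<open>i\<close>.
\<close>

definition wire_pos :: "(int \<Rightarrow> int) \<Rightarrow> int \<Rightarrow> int \<Rightarrow> int" where
  "wire_pos \<pi> c x = min (2 * x + 1) (2 * (\<pi> x - c))"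

text \<open>The horizontal part of wire \<open>i\<close> meets the vertical part of wire
  \<open>j\<close> in row \<open>i\<close> and column \<open>\<pi> j\<close>, a cell of diagonal
  \<open>c\<close>.\<close>

definition crossing :: "(int \<Rightarrow> int) \<Rightarrow> int \<Rightarrow> int \<Rightarrow> int \<Rightarrow> bool" where
  "crossing \<pi> c i j \<longleftrightarrow> i < j \<and> \<pi> j = i + c \<and> \<pi> j < \<pi> i"

definition crossing_set :: "(int \<Rightarrow> int) \<Rightarrow> int \<Rightarrow> (int \<Rightarrow> int) \<Rightarrow> int set" where
  "crossing_set \<pi> c f = f ` {j. \<exists>i. crossing \<pi> c i j}"

definition wire_order :: "(int \<Rightarrow> int) \<Rightarrow> int \<Rightarrow> (int \<Rightarrow> int) \<Rightarrow> bool" where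
  "wire_order \<pi> c f \<longleftrightarrow> (\<forall>x y. f x < f y \<longleftrightarrow> wire_pos \<pi> c x < wire_pos \<pi> c y)"

lemma crossing_setE:
  assumes "a \<in> crossing_set \<pi> c f"
  obtains i j where "crossing \<pi> c i j" "a = f j"
  using assms by (auto simp: crossing_set_def)

lemma wire_pos_inj:
  assumes "inj \<pi>" "wire_pos \<pi> c x = wire_pos \<pi> c y"
  shows "x = y"
proof -
  have "x = y \<or> \<pi> x = \<pi> y"
  proof -
    have "2 * a + 1 \<noteq> 2 * b" for a b :: int by presburger
    from this[of x "\<pi> y - c"] this[of y "\<pi> x - c"] show ?thesis
      using assms(2) by (simp add: wire_pos_def min_def split: if_splits)
  qed
  then show ?thesis using injD[OF assms(1)] by blast
qed

text \<open>The two wires leave their cell at the consecutive positions \<open>2 * i\<close> and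
  \<open>2 * i + 1\<close>, so no wire ranks between them; surjectivity of \<open>f\<close> then
  forbids a gap.\<close>

lemma crossing_adjacent:
  assumes "bij f" "wire_order \<pi> c f" "crossing \<pi> c i j"
  shows "f i = f j + 1"
proof -
  have pos: "wire_pos \<pi> c i = 2 * i + 1" "wire_pos \<pi> c j = 2 * i"
    using assms(3) by (auto simp: crossing_def wire_pos_def)
  then have "f j < f i" using assms(2) by (simp add: wire_order_def)
  obtain z where z: "f z = f j + 1" using assms(1) by (metis bij_pointE)
  have "\<not> f z < f i"
  proof
    assume "f z < f i"
    then have "wire_pos \<pi> c z < 2 * i + 1" using assms(2) pos by (simp add: wire_order_def)
    moreover have "f j < f z" using z by simp
    then have "2 * i < wire_pos \<pi> c z" using assms(2) pos by (simp add: wire_order_def)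
    ultimately show False by simp
  qed
  then show ?thesis using z \<open>f j < f i\<close> by simp
qed

text \<open>Overlapping pairs would share a wire \<open>i\<close> that is horizontal in one crossing
  and vertical in another on the same diagonal, giving
  \<open>\<pi> i < i + c = \<pi> j\<close>.\<close>

lemma crossing_set_sparse:
  assumes "bij f" "wire_order \<pi> c f"
  shows "sparse (crossing_set \<pi> c f)"
  unfolding sparse_def
proof
  fix a assume "a \<in> crossing_set \<pi> c f"
  then obtain i j where ij: "crossing \<pi> c i j" "a = f j" by (rule crossing_setE)
  show "a + 1 \<notin> crossing_set \<pi> c f"
  proof
    assume "a + 1 \<in> crossing_set \<pi> c f"
    then obtain i' j' where "crossing \<pi> c i' j'" "f i = f j'"
      using crossing_adjacent[OF assms ij(1)] ij(2) by (auto simp: crossing_set_def)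
    then have "crossing \<pi> c i' i" using assms(1) by (metis bij_is_inj injD)
    then show False using ij(1) by (auto simp: crossing_def)
  qed
qed

lemma crossing_set_periodic:
  assumes "bij f" "\<And>i. f (i + int n) = f i + int n" "\<And>i. \<pi> (i + int n) = \<pi> i + int n"
  shows "periodic_set n (crossing_set \<pi> c f)"
proof -
  have shift: "crossing \<pi> c (i + int n) (j + int n) \<longleftrightarrow> crossing \<pi> c i j" for i j
    using assms(3) by (auto simp: crossing_def)
  have "f j + int n \<in> crossing_set \<pi> c f \<longleftrightarrow> f j \<in> crossing_set \<pi> c f" for j
  proof -
    have mem: "f x \<in> crossing_set \<pi> c f \<longleftrightarrow> (\<exists>i. crossing \<pi> c i x)" for x
      using bij_is_inj[OF assms(1)] by (auto simp: crossing_set_def dest: injD)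
    have "(\<exists>i. crossing \<pi> c i (j + int n)) \<longleftrightarrow> (\<exists>i. crossing \<pi> c i j)"
      using shift by (metis diff_add_cancel)
    then show ?thesis using mem assms(2) by metis
  qed
  then show ?thesis unfolding periodic_set_def using assms(1) by (metis bij_pointE)
qed

text \<open>Leaving diagonal \<open>c - 1\<close> means entering diagonal \<open>c\<close>. Wires in
  different cells keep their order; two wires in one cell cross there and exchange ranks.\<close>

lemma wire_order_step:
  assumes f: "bij f" "wire_order \<pi> c f" and \<pi>: "inj \<pi>"
  shows "wire_order \<pi> (c - 1) (swaps (crossing_set \<pi> c f) \<circ> f)"
proof -
  define R where "R = crossing_set \<pi> c f"
  define g where "g = swaps R \<circ> f"
  have sp: "sparse R" unfolding R_def by (rule crossing_set_sparse[OF f])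
  have less: "g x < g y" if lt: "wire_pos \<pi> (c - 1) x < wire_pos \<pi> (c - 1) y" for x y
  proof -
    \<comment> \<open>row of the cell of diagonal \<open>c\<close> that a wire passes through\<close>
    define A where "A z = min z (\<pi> z - c)" for z
    have "x \<noteq> y" using lt by auto
    show ?thesis
    proof (cases "A x = A y")
      case True
      then have eq: "min x (\<pi> x - c) = min y (\<pi> y - c)" by (simp only: A_def)
      have ne: "\<pi> x \<noteq> \<pi> y" using \<open>x \<noteq> y\<close> injD[OF \<pi>] by blast
      \<comment> \<open>In a shared cell the horizontal wire enters first, so it is
        \<open>x\<close>.\<close>
      have less: "x < y"
        using eq lt ne \<open>x \<noteq> y\<close> by (simp add: wire_pos_def min_def split: if_splits)
      then have col: "\<pi> y = x + c" using eq ne by linarith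
      then have "\<pi> y < \<pi> x" using eq ne less by linarith
      with less col have cross: "crossing \<pi> c x y" by (simp add: crossing_def)
      then have "f y \<in> R" unfolding R_def crossing_set_def by blast
      moreover have "f x = f y + 1" by (rule crossing_adjacent[OF f cross])
      ultimately show ?thesis using sp by (simp add: g_def swaps_def sparse_def)
    next
      case False
      \<comment> \<open>A wire enters its cell at \<open>2 * A z + 1\<close> or
        \<open>2 * A z + 2\<close> and leaves it at \<open>2 * A z\<close> or
        \<open>2 * A z + 1\<close>, so distinct rows decide both orders.\<close>
      then have "A x < A y"
        using lt by (simp add: A_def wire_pos_def min_def split: if_splits)
      then have "wire_pos \<pi> c x < wire_pos \<pi> c y"
        by (simp add: A_def wire_pos_def min_def split: if_splits)
      then have "f x < f y" using f(2) by (simp add: wire_order_def)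
      moreover have "\<not> (f x \<in> R \<and> f y = f x + 1)"
      proof
        assume *: "f x \<in> R \<and> f y = f x + 1"
        then obtain i j where ij: "crossing \<pi> c i j" "f x = f j"
          by (auto simp: R_def crossing_set_def)
        moreover have "f y = f i" using crossing_adjacent[OF f ij(1)] * ij(2) by linarith
        ultimately have "x = j" "y = i" using bij_is_inj[OF f(1)] by (metis injD)+
        then show False using ij(1) False by (auto simp: A_def crossing_def)
      qed
      ultimately show ?thesis using sp by (simp add: g_def swaps_less)
    qed
  qed
  have "wire_pos \<pi> (c - 1) x < wire_pos \<pi> (c - 1) y" if "g x < g y" for x y
    using that less wire_pos_inj[OF \<pi>] by (metis less_asym linorder_less_linear order_less_irrefl)
  then show ?thesis using less unfolding wire_order_def g_def R_def by blast
qed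

lemma increasing_bij_int:
  fixes f :: "int \<Rightarrow> int"
  assumes "bij f" "\<And>x y. x < y \<Longrightarrow> f x < f y"
  shows "f x = x + f 0"
proof -
  have suc: "f (x + 1) = f x + 1" for x
  proof -
    obtain z where z: "f z = f x + 1" using assms(1) by (metis bij_pointE)
    have "\<not> z \<le> x" using assms(2)[of z x] z by (cases "z = x") auto
    moreover have "\<not> x + 1 < z" using assms(2)[of "x + 1" z] assms(2)[of x "x + 1"] z by auto
    ultimately have "z = x + 1" by simp
    then show ?thesis using z by simp
  qed
  show ?thesis
  proof (induction x rule: int_induct[where k = 0])
    case (step2 i)
    then show ?case using suc[of "i - 1"] by simp
  qed (simp_all add: suc)
qed

section \<open>Undoing the diagonals from \<open>w - 1\<close> downwards\<close>

primrec stage :: "(int \<Rightarrow> int) \<Rightarrow> int \<Rightarrow> nat \<Rightarrow> int \<Rightarrow> int" where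
  "stage \<pi> w 0 = \<pi>"
| "stage \<pi> w (Suc m) = swaps (crossing_set \<pi> (w - 1 - int m) (stage \<pi> w m)) \<circ> stage \<pi> w m"

locale banded =
  fixes n :: nat and w :: int and \<pi> :: "int \<Rightarrow> int"
  assumes bij_\<pi>: "bij \<pi>"
    and periodic_\<pi>: "\<And>i. \<pi> (i + int n) = \<pi> i + int n"
    and band: "\<And>i. \<bar>\<pi> i - i\<bar> \<le> w"
begin

abbreviation R :: "nat \<Rightarrow> int set" where
  "R m \<equiv> crossing_set \<pi> (w - 1 - int m) (stage \<pi> w m)"

text \<open>The exit position is \<open>2 * (\<pi> x - w) + 2\<close>, or one less if
  \<open>\<pi> x = x + w\<close>, so the order is that of the columns.\<close>

lemma wire_order_\<pi>: "wire_order \<pi> (w - 1) \<pi>"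
proof -
  have "wire_pos \<pi> (w - 1) x < wire_pos \<pi> (w - 1) y" if "\<pi> x < \<pi> y" for x y
    using that band[of x] band[of y] by (simp add: wire_pos_def min_def abs_le_iff)
  then show ?thesis unfolding wire_order_def
    using bij_is_inj[OF bij_\<pi>] by (metis injD less_asym linorder_less_linear)
qed

lemma stage_bij_wire_order:
  "bij (stage \<pi> w m) \<and> wire_order \<pi> (w - 1 - int m) (stage \<pi> w m)"
proof (induction m)
  case 0
  then show ?case using bij_\<pi> wire_order_\<pi> by simp
next
  case (Suc m)
  then have "sparse (R m)" by (simp add: crossing_set_sparse)
  then have "bij (stage \<pi> w (Suc m))"
    unfolding stage.simps using Suc by (intro bij_comp bij_swaps) auto
  moreover have "wire_order \<pi> (w - 1 - int m - 1) (stage \<pi> w (Suc m))"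
    unfolding stage.simps
    by (rule wire_order_step) (use Suc bij_is_inj[OF bij_\<pi>] in auto)
  moreover have "w - 1 - int m - 1 = w - 1 - int (Suc m)" by simp
  ultimately show ?case by metis
qed

lemmas stage_bij = stage_bij_wire_order[THEN conjunct1]
lemmas stage_wire_order = stage_bij_wire_order[THEN conjunct2]

lemma sparse_R: "sparse (R m)"
  by (simp add: crossing_set_sparse stage_bij_wire_order)

lemma stage_periodic: "stage \<pi> w m (i + int n) = stage \<pi> w m i + int n"
proof (induction m arbitrary: i)
  case 0
  then show ?case by (simp add: periodic_\<pi>)
next
  case (Suc m)
  then show ?case
    by (simp add: swaps_add_period crossing_set_periodic stage_bij periodic_\<pi>)
qed

lemma periodic_R: "periodic_set n (R m)"
  by (simp add: crossing_set_periodic stage_bij stage_periodic periodic_\<pi>)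

text \<open>Each swap is an involution, so the swaps that undo the diagonals reappear as factors of
  \<open>\<pi>\<close>. The index \<open>j - 1\<close> arises because factors are numbered from
  1.\<close>

lemma stage_decompose:
  "\<pi> = foldr (\<circ>) (map (\<lambda>j. swaps (R (j - 1))) [1..<Suc m]) id \<circ> stage \<pi> w m"
proof (induction m)
  case (Suc m)
  define \<sigma> where "\<sigma> = (\<lambda>j. swaps (R (j - 1)))"
  have fold: "foldr (\<circ>) fs g = foldr (\<circ>) fs id \<circ> g" for fs and g :: "int \<Rightarrow> int"
    by (induction fs) (simp_all add: o_assoc)
  have "[1..<Suc (Suc m)] = [1..<Suc m] @ [Suc m]" by simp
  then have "foldr (\<circ>) (map \<sigma> [1..<Suc (Suc m)]) id = foldr (\<circ>) (map \<sigma> [1..<Suc m]) (\<sigma> (Suc m))"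
    by (simp del: upt_Suc)
  also have "\<dots> = foldr (\<circ>) (map \<sigma> [1..<Suc m]) id \<circ> \<sigma> (Suc m)" by (rule fold)
  finally have step: "foldr (\<circ>) (map \<sigma> [1..<Suc (Suc m)]) id =
    foldr (\<circ>) (map \<sigma> [1..<Suc m]) id \<circ> \<sigma> (Suc m)" .
  have "\<sigma> (Suc m) \<circ> stage \<pi> w (Suc m) = stage \<pi> w m"
    using swaps_swaps[OF sparse_R] by (simp add: \<sigma>_def fun_eq_iff)
  then show ?case using Suc step unfolding \<sigma>_def[symmetric] by (metis o_assoc)
qed simp

section \<open>Bounding the final shift\<close>

text \<open>A left-to-right maximum is never the vertical wire of a crossing, and only vertical
  wires move up.\<close>

lemma stage_le:
  assumes "\<And>y. y < x \<Longrightarrow> \<pi> y < \<pi> x"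
  shows "stage \<pi> w m x \<le> \<pi> x"
proof (induction m)
  case (Suc m)
  have "stage \<pi> w m x \<notin> R m"
    using assms injD[OF bij_is_inj[OF stage_bij]] unfolding crossing_set_def crossing_def
    by fastforce
  then show ?case using Suc by (simp add: swaps_def)
qed simp

text \<open>A right-to-left minimum is never the horizontal wire of a crossing, and only horizontal
  wires move down.\<close>

lemma stage_ge:
  assumes "\<And>y. x < y \<Longrightarrow> \<pi> x < \<pi> y"
  shows "\<pi> x \<le> stage \<pi> w m x"
proof (induction m)
  case (Suc m)
  have "stage \<pi> w m x - 1 \<notin> R m"
  proof
    assume "stage \<pi> w m x - 1 \<in> R m"
    then obtain i j where ij: "crossing \<pi> (w - 1 - int m) i j"
        "stage \<pi> w m x - 1 = stage \<pi> w m j"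
      by (rule crossing_setE)
    have "stage \<pi> w m i = stage \<pi> w m j + 1"
      by (rule crossing_adjacent[OF stage_bij stage_wire_order ij(1)])
    then have "x = i" using injD[OF bij_is_inj[OF stage_bij], of m x i] ij(2) by linarith
    then show False using ij(1) assms[of j] by (auto simp: crossing_def)
  qed
  then show ?case using Suc by (simp add: swaps_def)
qed simp

lemma left_to_right_maximum: obtains x where "\<And>y. y < x \<Longrightarrow> \<pi> y < \<pi> x"
proof -
  have w: "0 \<le> w" using band[of 0] by linarith
  \<comment> \<open>Any \<open>y < -2*w\<close> has \<open>\<pi> y < - w \<le> \<pi> 0\<close>, so a
    maximum over this window also exceeds all values to its left.\<close>
  define M where "M = Max (\<pi> ` {-2*w..0})"
  have fin: "finite (\<pi> ` {-2*w..0})" "\<pi> ` {-2*w..0} \<noteq> {}" using w by auto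
  obtain x where x: "x \<in> {-2*w..0}" "\<pi> x = M"
    using Max_in[OF fin] unfolding M_def by auto
  have "\<pi> y < \<pi> x" if "y < x" for y
  proof (cases "y \<ge> -2*w")
    case True
    then have "\<pi> y \<le> M" unfolding M_def using x that by (intro Max_ge fin) auto
    then show ?thesis using x that bij_is_inj[OF bij_\<pi>] by (metis injD less_le)
  next
    case False
    have "\<pi> 0 \<le> M" unfolding M_def using w by (intro Max_ge fin) auto
    then show ?thesis using False band[of y] band[of 0] x by linarith
  qed
  then show thesis using that by blast
qed

text \<open>Conjugation by negation preserves the locale assumptions and reduces this to
  left-to-right maxima.\<close>

lemma right_to_left_minimum: obtains x where "\<And>y. x < y \<Longrightarrow> \<pi> x < \<pi> y"
proof -
  have "bij (\<lambda>i. - \<pi> (- i))"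
    using bij_comp[OF bij_comp[OF bij_uminus bij_\<pi>] bij_uminus] by (simp add: o_def)
  moreover have "- \<pi> (- (i + int n)) = - \<pi> (- i) + int n" for i
    using periodic_\<pi>[of "- i - int n"] by simp
  moreover have "\<bar>- \<pi> (- i) - i\<bar> \<le> w" for i using band[of "- i"] by linarith
  ultimately interpret neg: banded n w "\<lambda>i. - \<pi> (- i)" by unfold_locales
  obtain x where x: "\<And>y. y < x \<Longrightarrow> - \<pi> (- y) < - \<pi> (- x)"
    using neg.left_to_right_maximum by blast
  have "\<pi> (- x) < \<pi> y" if "- x < y" for y using x[of "- y"] that by simp
  then show thesis using that by blast
qed

lemma stage_last:
  assumes "int m = 2 * w - 1"
  obtains k where "\<bar>k\<bar> \<le> w" "stage \<pi> w m = shift_pow k"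
proof -
  define f where "f = stage \<pi> w m"
  have "w - 1 - int m = - w" using assms by simp
  then have f: "bij f" "wire_order \<pi> (- w) f"
    unfolding f_def by (metis stage_bij_wire_order)+
  have "f x < f y" if "x < y" for x y
  proof -
    \<comment> \<open>Here the position is \<open>2 * x + 1\<close>, or \<open>2 * x\<close> if
      \<open>\<pi> x = x - w\<close>, so the wires are back in the order of their rows.\<close>
    have "wire_pos \<pi> (- w) x < wire_pos \<pi> (- w) y"
      using that band[of x] band[of y] by (simp add: wire_pos_def min_def abs_le_iff)
    then show ?thesis using f(2) by (simp add: wire_order_def)
  qed
  then have shift: "f x = x + f 0" for x by (rule increasing_bij_int[OF f(1)])
  \<comment> \<open>As \<open>f\<close> is a shift, comparing it with \<open>\<pi>\<close> at one
    point bounds its constant on one side.\<close>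
  obtain x where "\<And>y. y < x \<Longrightarrow> \<pi> y < \<pi> x" using left_to_right_maximum by blast
  then have "f x \<le> \<pi> x" unfolding f_def by (rule stage_le)
  then have "f 0 \<le> w" using shift[of x] band[of x] by linarith
  moreover obtain z where "\<And>y. z < y \<Longrightarrow> \<pi> z < \<pi> y" using right_to_left_minimum by blast
  then have "\<pi> z \<le> f z" unfolding f_def by (rule stage_ge)
  then have "- w \<le> f 0" using shift[of z] band[of z] by linarith
  ultimately have "\<bar>f 0\<bar> \<le> w" by linarith
  moreover have "f = shift_pow (f 0)" by (intro ext) (simp only: shift_pow_def shift[symmetric])
  ultimately show thesis using that f_def by metis
qed

end

section \<open>Assembling the factorization from the \<open>2 * w - 1\<close> diagonals\<close>

theorem theorem3p1:
  fixes n w :: nat and \<pi> :: "int \<Rightarrow> int"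
  assumes "n \<ge> 2" and "w \<ge> 1" and "2 * w \<le> n"
    and "bij \<pi>" and "\<forall>i. \<pi> (i + int n) = \<pi> i + int n"
    and "\<forall>i. \<bar>\<pi> i - i\<bar> \<le> int w"
  shows "\<exists>\<sigma> :: nat \<Rightarrow> int \<Rightarrow> int. \<exists>k :: int.
           (\<forall>j \<in> {1..<2*w}. nonadj_transp_product n (\<sigma> j)) \<and>
           \<bar>k\<bar> \<le> int w \<and>
           \<pi> = foldr (\<circ>) (map \<sigma> [1..<2*w]) id \<circ> shift_pow k"
proof -
  interpret banded n "int w" \<pi> using assms(4-6) by unfold_locales auto
  have "int (2 * w - 1) = 2 * int w - 1" using assms(2) by linarith
  then obtain k where k: "\<bar>k\<bar> \<le> int w" "stage \<pi> (int w) (2 * w - 1) = shift_pow k"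
    by (rule stage_last)
  have "nonadj_transp_product n (swaps (R (j - 1)))" for j
    by (rule nonadj_transp_product_swaps[OF assms(1) periodic_R sparse_R])
  moreover have "Suc (2 * w - 1) = 2 * w" using assms(2) by simp
  then have "\<pi> = foldr (\<circ>) (map (\<lambda>j. swaps (R (j - 1))) [1..<2*w]) id \<circ> shift_pow k"
    using stage_decompose[of "2 * w - 1"] k(2) by (simp only:)
  ultimately show ?thesis using k(1)
    by (intro exI[of _ "\<lambda>j. swaps (R (j - 1))"] exI[of _ k] conjI ballI)
qed

end
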